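(* For all integers $n,k\ge 0$, the polynomial $W_{n,k}(t)=\sum_{m=0}^{k}w_{n,k,m}t^m$ is real-rooted.
   Context: A Dyck path of semilength $n$ is a word in the letters $U,D$ with $n$ copies of each letter such that no prefix contains more $D$'s than $U$'s. A $UD$-factor (resp. $UUD$-factor) is an occurrence of $UD$ (resp. $UUD$) as a consecutive subword. $w_{n,k,m}$ denotes the number of Dyck paths of semilength $n$ with exactly $k$ $UD$-factors and exactly $m$ $UUD$-factors. A polynomial with real coefficients is real-rooted if all its roots are real; by convention constant polynomials (including $0$) are real-rooted. *)

theory Defs
  imports Complex_Main "HOL-Library.Sublist" "HOL-Computational_Algebra.Polynomial"
begin

datatype step = U | D

definition dyck_path :: "nat \<Rightarrow> step list \<Rightarrow> bool" where
  "dyck_path n p \<longleftrightarrow>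
     count_list p U = n \<and> count_list p D = n \<and>
     (\<forall>q. prefix q p \<longrightarrow> count_list q D \<le> count_list q U)"

(* occurrences are counted by starting position, so overlapping ones are all counted *)
definition factor_count :: "'a list \<Rightarrow> 'a list \<Rightarrow> nat" where
  "factor_count v p =
     card {i. i + length v \<le> length p \<and> take (length v) (drop i p) = v}"

definition w :: "nat \<Rightarrow> nat \<Rightarrow> nat \<Rightarrow> nat" where
  "w n k m =
     card {p. dyck_path n p \<and> factor_count [U, D] p = k \<and> factor_count [U, U, D] p = m}"

definition W :: "nat \<Rightarrow> nat \<Rightarrow> real poly" where
  "W n k = (\<Sum>m = 0..k. monom (real (w n k m)) m)"

(* The roots range over the complex numbers. The first disjunct is the convention that constant
   polynomials are real-rooted; it matters only for the zero polynomial. *)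
definition real_rooted :: "real poly \<Rightarrow> bool" where
  "real_rooted p \<longleftrightarrow>
     degree p = 0 \<or> (\<forall>z::complex. poly (map_poly of_real p) z = 0 \<longrightarrow> z \<in> \<real>)"

end

theory Submission
  imports Defs "HOL-Computational_Algebra.Computational_Algebra"
begin

text \<open>
  Weight a path by the product of \<open>x c\<close> over its down steps, where \<open>c\<close> is the number of up steps
  immediately before the down step. Peeling off the first down step gives a recurrence which, by
  \<open>(\<phi>\<^sup>L)' = L \<phi>\<^sup>L\<^sup>-\<^sup>1 \<phi>'\<close>, has the Lagrange type solution \<open>(n + 1) \<Sum> weights = [z\<^sup>n] \<phi>(z)\<^sup>n\<^sup>+\<^sup>1\<close> with
  \<open>\<phi> = \<Sum>\<^sub>c x\<^sub>c z\<^sup>c\<close>. A \<open>UD\<close>-factor marks \<open>c \<ge> 1\<close> and a \<open>UUD\<close>-factor marks \<open>c \<ge> 2\<close>, so the choice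
  \<open>\<phi> = 1 + y z (1 + t z / (1 - z))\<close> yields
  \<open>(n + 1) w(n, k, m) = binom(n + 1, k) binom(k, m) binom(n - k - 1, m - 1)\<close>.

  By the Leibniz rule, with \<open>N = n - k\<close>, the \<open>k\<close>-th derivative of \<open>x\<^sup>N (1 + x)\<^sup>k\<^sup>-\<^sup>1\<close> is a multiple of
  \<open>\<Sum>\<^sub>m binom(k, m) binom(N - 1, m - 1) x\<^sup>N\<^sup>-\<^sup>m (1 + x)\<^sup>m\<^sup>-\<^sup>1\<close>. Its roots are real because differentiation
  preserves real-rootedness, and the substitution \<open>t = (1 + x) / x\<close> carries them to those of \<open>W n k\<close>.
\<close>

section \<open>Lattice paths from an arbitrary starting height\<close>

text \<open>\<open>descends h p\<close>: started at height \<open>h\<close>, the path \<open>p\<close> stays nonnegative and ends at height 0.\<close>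
fun descends :: "nat \<Rightarrow> step list \<Rightarrow> bool" where
  "descends h [] \<longleftrightarrow> h = 0"
| "descends h (U # p) \<longleftrightarrow> descends (Suc h) p"
| "descends h (D # p) \<longleftrightarrow> h > 0 \<and> descends (h - 1) p"

text \<open>The second argument is the number of up steps read since the last down step.\<close>
fun ascent_weight :: "(nat \<Rightarrow> real) \<Rightarrow> nat \<Rightarrow> step list \<Rightarrow> real" where
  "ascent_weight x a [] = 1"
| "ascent_weight x a (U # p) = ascent_weight x (Suc a) p"
| "ascent_weight x a (D # p) = x a * ascent_weight x 0 p"

definition paths :: "nat \<Rightarrow> nat \<Rightarrow> step list set" where
  "paths h u = {p. descends h p \<and> count_list p U = u}"

lemma descends_length: "descends h p \<Longrightarrow> length p = 2 * count_list p U + h"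
  by (induction h p rule: descends.induct) auto

lemma finite_paths: "finite (paths h u)"
proof (rule finite_subset)
  show "paths h u \<subseteq> {p. set p \<subseteq> {U, D} \<and> length p = 2 * u + h}"
    using descends_length step.exhaust by (auto simp: paths_def)
qed (rule finite_lists_length_eq, simp)

text \<open>The starting height \<open>h\<close> is free so that induction can follow the steps. At
  \<open>h = 0\<close> this turns the prefix condition of \<open>dyck_path\<close> into the
  recursive form.\<close>

lemma descends_iff:
  "descends h p \<longleftrightarrow> count_list p D = h + count_list p U \<and>
     (\<forall>q. prefix q p \<longrightarrow> count_list q D \<le> h + count_list q U)"
proof (induction h p rule: descends.induct)
  case (1 h)
  then show ?case by auto
next
  case (2 h p)
  then show ?case by (auto simp: prefix_Cons)
next
  case (3 h p)
  show ?case
  proof (cases "h > 0")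
    case True
    then obtain g where "h = Suc g" by (cases h) auto
    then show ?thesis using 3 by (auto simp: prefix_Cons)
  next
    case False
    \<comment> \<open>The one-letter prefix already falls below the axis when the path starts at
      height 0.\<close>
    have "prefix [D] (D # p)" by simp
    with False show ?thesis
      by (metis add_0 count_list.simps(1,2) descends.simps(3) le_zero_eq neq0_conv
          step.distinct(2) One_nat_def add_gr_0 zero_less_one)
  qed
qed

lemma dyck_path_iff: "dyck_path n p \<longleftrightarrow> p \<in> paths 0 n"
  by (auto simp: dyck_path_def paths_def descends_iff)

lemma paths_0_0: "paths 0 0 = {[]}"
  using descends_length by (fastforce simp: paths_def)

lemma paths_rec:
  assumes "h + u > 0"
  shows "paths h u = (if u > 0 then (#) U ` paths (Suc h) (u - 1) else {}) \<union>
                     (if h > 0 then (#) D ` paths (h - 1) u else {})"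
    (is "_ = ?R")
proof (intro set_eqI)
  fix p
  show "p \<in> paths h u \<longleftrightarrow> p \<in> ?R"
  proof (cases p)
    case Nil
    then show ?thesis using assms by (auto simp: paths_def)
  next
    case (Cons s q)
    then show ?thesis by (cases s) (auto simp: paths_def)
  qed
qed

section \<open>Weighted path sums in closed form\<close>

text \<open>Height \<open>h\<close> and pending run \<open>a\<close> of up steps are both parameters
  because removing the first step can change both.\<close>

definition path_sum :: "(nat \<Rightarrow> real) \<Rightarrow> nat \<Rightarrow> nat \<Rightarrow> nat \<Rightarrow> real" where
  "path_sum x h a u = (\<Sum>p\<in>paths h u. ascent_weight x a p)"

lemma path_sum_rec:
  assumes "h + u > 0"
  shows "path_sum x h a u =
    (if u > 0 then path_sum x (Suc h) (Suc a) (u - 1) else 0) +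
    (if h > 0 then x a * path_sum x (h - 1) 0 u else 0)"
proof -
  have "path_sum x h a u =
      sum (ascent_weight x a) (if u > 0 then (#) U ` paths (Suc h) (u - 1) else {}) +
      sum (ascent_weight x a) (if h > 0 then (#) D ` paths (h - 1) u else {})"
    unfolding path_sum_def paths_rec[OF assms]
    by (rule sum.union_disjoint) (auto simp: finite_paths)
  then show ?thesis
    by (simp add: path_sum_def sum.reindex sum_distrib_left)
qed

text \<open>With \<open>L = h + u\<close>, the left side combines the plain convolution
  \<open>A\<close> of \<phi> and \<open>\<phi> ^ L\<close> with the convolution \<open>B\<close>
  weighted by \<open>c\<close>. Comparing coefficients in
  \<open>z (\<phi> ^ (L + 1))' = (L + 1) z \<phi>' \<phi> ^ L\<close> expresses \<open>B\<close>
  through \<open>A\<close>.\<close>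

lemma fps_power_Suc_nth_sum:
  fixes \<phi> :: "real fps"
  assumes "h + u > 0"
  shows "(\<Sum>c\<le>u. \<phi> $ c * (real (h + c) / real (h + u) * (\<phi> ^ (h + u)) $ (u - c))) =
         real (Suc h) / real (Suc (h + u)) * (\<phi> ^ Suc (h + u)) $ u"
proof -
  define L where "L = h + u"
  have L: "real L > 0" using assms by (simp only: L_def of_nat_0_less_iff)
  define A where "A = (\<Sum>c\<le>u. \<phi> $ c * (\<phi> ^ L) $ (u - c))"
  define B where "B = (\<Sum>c\<le>u. real c * \<phi> $ c * (\<phi> ^ L) $ (u - c))"
  have A: "A = (\<phi> ^ Suc L) $ u"
    by (simp add: A_def fps_mult_nth atLeast0AtMost)
  have X: "(fps_X * fps_deriv f) $ c = real c * f $ c" for f :: "real fps" and c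
    by (cases c) simp_all
  have "real u * A = (fps_X * fps_deriv (\<phi> ^ Suc L)) $ u"
    by (simp only: X A)
  also have "fps_X * fps_deriv (\<phi> ^ Suc L) = fps_const (real (Suc L)) * ((fps_X * fps_deriv \<phi>) * \<phi> ^ L)"
    by (subst fps_deriv_power) (simp add: mult_ac)
  also have "\<dots> $ u = real (Suc L) * B"
    by (simp only: fps_mult_left_const_nth fps_mult_nth[of _ "\<phi> ^ L"] X B_def atLeast0AtMost)
  finally have AB: "real u * A = real (Suc L) * B" .
  have "(\<Sum>c\<le>u. \<phi> $ c * (real (h + c) / real L * (\<phi> ^ L) $ (u - c))) = (real h * A + B) / real L"
    unfolding A_def B_def
    by (simp add: sum_distrib_left sum_divide_distrib flip: sum.distrib) (rule sum.cong; simp add: field_simps)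
  also have "\<dots> = real (Suc h) / real (Suc L) * A"
  proof -
    define l s where "l = real L" and "s = real (Suc L)"
    have pos: "l > 0" "s > 0" using L by (simp_all add: l_def s_def)
    have B: "B = real u * A / s"
      using AB pos by (simp only: s_def[symmetric]) (simp add: field_simps)
    \<comment> \<open>The choice of \<open>L\<close> makes the numerator divisible by
      \<open>L\<close>, which cancels the denominator.\<close>
    have "real h * s + real u = l * real (Suc h)"
      by (simp add: l_def s_def L_def algebra_simps)
    moreover have "real h * A + B = (real h * s + real u) * A / s"
      using pos by (simp add: B field_simps)
    ultimately have "real h * A + B = l * real (Suc h) * A / s"
      by (simp only:)
    then show ?thesis
      using pos by (simp only: l_def[symmetric] s_def[symmetric]) simp
  qed
  finally show ?thesis
    by (simp only: A L_def)
qed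

text \<open>Here \<open>c\<close> counts the further up steps before the first down step. The factor
  after \<open>x (a + c)\<close> is the total weight of what can follow that down step; it is 0 for
  \<open>h + c = 0\<close>, where no down step is possible.\<close>

lemma path_sum_eq:
  assumes "x 0 = 1" "h + u > 0"
  shows "path_sum x h a u =
    (\<Sum>c\<le>u. x (a + c) * (real (h + c) / real (h + u) * (Abs_fps x ^ (h + u)) $ (u - c)))"
  using assms(2)
\<comment> \<open>The measure is the common length of the paths.\<close>
proof (induction "2 * u + h" arbitrary: h a u rule: less_induct)
  case less
  let ?f = "\<lambda>c. x (a + c) * (real (h + c) / real (h + u) * (Abs_fps x ^ (h + u)) $ (u - c))"
  have up: "path_sum x (Suc h) (Suc a) (u - 1) = (\<Sum>c<u. ?f (Suc c))" if "u > 0"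
  proof -
    obtain v where v: "u = Suc v" using \<open>u > 0\<close> by (cases u) auto
    show ?thesis
      using less.hyps[of v "Suc h" "Suc a"] by (simp add: v lessThan_Suc_atMost)
  qed
  have down: "x a * path_sum x (h - 1) 0 u = ?f 0" if "h > 0"
  proof -
    obtain g where g: "h = Suc g" using \<open>h > 0\<close> by (cases h) auto
    \<comment> \<open>The run restarts at 0, so \<open>fps_power_Suc_nth_sum\<close> collapses the
      induction hypothesis to one coefficient. For \<open>g + u = 0\<close> only the empty path is
      left, and \<open>x 0 = 1\<close> gives the value.\<close>
    have "path_sum x g 0 u = real (Suc g) / real (Suc (g + u)) * (Abs_fps x ^ Suc (g + u)) $ u"
    proof (cases "g + u > 0")
      case True
      then show ?thesis
        using less.hyps[of u g 0] fps_power_Suc_nth_sum[of g u "Abs_fps x"] g by simp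
    next
      case False
      then show ?thesis
        using assms(1) by (simp add: path_sum_def paths_0_0)
    qed
    then show ?thesis by (simp add: g)
  qed
  have "(\<Sum>c\<le>u. ?f c) = ?f 0 + (\<Sum>c<u. ?f (Suc c))"
    by (rule sum.atMost_shift)
  then show ?case
    using path_sum_rec[OF less.prems, of x a] up down by auto
qed

lemma sum_ascent_weight:
  assumes "x 0 = 1"
  shows "real (Suc n) * (\<Sum>p\<in>paths 0 n. ascent_weight x 0 p) = (Abs_fps x ^ Suc n) $ n"
proof (cases "n = 0")
  case True
  then show ?thesis using assms by (simp add: paths_0_0)
next
  case False
  then have "path_sum x 0 0 n = 1 / real (Suc n) * (Abs_fps x ^ Suc n) $ n"
    using path_sum_eq[of x 0 n 0] fps_power_Suc_nth_sum[of 0 n "Abs_fps x"] assms by simp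
  then show ?thesis by (simp add: path_sum_def)
qed

section \<open>Counting factors along runs of up steps\<close>

lemma finite_factor_positions:
  "finite {i. i + length v \<le> length p \<and> take (length v) (drop i p) = v}"
  by (rule finite_subset[of _ "{..length p}"]) auto

lemma factor_count_Nil: "v \<noteq> [] \<Longrightarrow> factor_count v [] = 0"
  by (simp add: factor_count_def)

text \<open>An occurrence starts at position 0 or is an occurrence in the tail, shifted by
  one.\<close>

lemma factor_count_Cons:
  assumes "v \<noteq> []"
  shows "factor_count v (s # p) = (if prefix v (s # p) then 1 else 0) + factor_count v p"
proof -
  let ?A = "\<lambda>p. {i. i + length v \<le> length p \<and> take (length v) (drop i p) = v}"
  let ?Z = "if prefix v (s # p) then {0::nat} else {}"
  have pre: "prefix v q \<longleftrightarrow> length v \<le> length q \<and> take (length v) q = v" for q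
    by (metis append_eq_conv_conj prefix_def prefix_length_le take_is_prefix)
  have "?A (s # p) = ?Z \<union> Suc ` ?A p"
  proof (intro set_eqI)
    fix i
    show "i \<in> ?A (s # p) \<longleftrightarrow> i \<in> ?Z \<union> Suc ` ?A p"
      by (cases i) (auto simp: pre)
  qed
  moreover have "card (?Z \<union> Suc ` ?A p) = card ?Z + card (Suc ` ?A p)"
    by (rule card_Un_disjoint) (auto simp: finite_factor_positions)
  ultimately show ?thesis
    by (simp add: factor_count_def card_image)
qed

lemma factor_count_le_length: "v \<noteq> [] \<Longrightarrow> factor_count v p \<le> length p"
  by (induction p) (auto simp: factor_count_Nil factor_count_Cons)

text \<open>Each \<open>UUD\<close> contains a \<open>UD\<close> one position later. Hence cutting
  the sum over \<open>m\<close> off at \<open>k\<close> loses nothing.\<close>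

lemma factor_count_UUD_le: "factor_count [U, U, D] p \<le> factor_count [U, D] p"
  unfolding factor_count_def
proof (rule card_inj_on_le[of Suc])
  show "Suc ` {i. i + length [U, U, D] \<le> length p \<and> take (length [U, U, D]) (drop i p) = [U, U, D]}
     \<subseteq> {i. i + length [U, D] \<le> length p \<and> take (length [U, D]) (drop i p) = [U, D]}"
  proof clarsimp
    fix i
    assume "Suc (Suc (Suc i)) \<le> length p" "take (Suc (Suc (Suc 0))) (drop i p) = [U, U, D]"
    then show "take (Suc (Suc 0)) (drop (Suc i) p) = [U, D]"
      by (metis drop_Suc list.sel(3) tl_drop take_tl  diff_Suc_1)
  qed
qed (use finite_factor_positions[of "[U, D]" p] in auto)

lemma prefix_replicate_U_D:
  "prefix (replicate c U @ [D]) (replicate a U @ D # p) \<longleftrightarrow> a = c"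
proof (induction c arbitrary: a)
  case 0
  then show ?case by (cases a) auto
next
  case (Suc c)
  then show ?case by (cases a) auto
qed

lemma not_prefix_replicate_U_D: "\<not> prefix (replicate c U @ [D]) (replicate a U)"
  by (auto dest: set_mono_prefix)

lemma factor_count_replicate_U:
  "factor_count (replicate c U @ [D]) (replicate a U) = 0"
proof (induction a)
  case 0
  then show ?case by (simp add: factor_count_Nil)
next
  case (Suc a)
  then show ?case
    using not_prefix_replicate_U_D[of c "Suc a"] by (simp add: factor_count_Cons)
qed

text \<open>An occurrence ending at the first down step needs a run of at least \<open>c\<close> up
  steps and then starts at \<open>a - c\<close>; all others lie in \<open>p\<close>.\<close>

lemma factor_count_replicate_U_D:
  assumes "c > 0"
  shows "factor_count (replicate c U @ [D]) (replicate a U @ D # p) =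
    (if c \<le> a then 1 else 0) + factor_count (replicate c U @ [D]) p"
proof (induction a)
  case 0
  then show ?case
    using prefix_replicate_U_D[of c 0 p] assms by (simp add: factor_count_Cons)
next
  case (Suc a)
  then show ?case
    using prefix_replicate_U_D[of c "Suc a" p] by (auto simp: factor_count_Cons)
qed

section \<open>Generating function and explicit numbers\<close>

definition peak_weight :: "real \<Rightarrow> real \<Rightarrow> nat \<Rightarrow> real" where
  "peak_weight y t c = (if c = 0 then 1 else if c = 1 then y else y * t)"

lemma ascent_weight_peak_weight:
  "ascent_weight (peak_weight y t) a p =
     y ^ factor_count [U, D] (replicate a U @ p) * t ^ factor_count [U, U, D] (replicate a U @ p)"
proof -
  \<comment> \<open>Both patterns are written as a run of up steps followed by \<open>D\<close>, so
    that the lemmas on runs apply.\<close>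
  have "ascent_weight (peak_weight y t) a p =
     y ^ factor_count (replicate 1 U @ [D]) (replicate a U @ p) *
     t ^ factor_count (replicate 2 U @ [D]) (replicate a U @ p)"
  proof (induction "peak_weight y t" a p rule: ascent_weight.induct)
    case (1 a)
    then show ?case by (simp only: ascent_weight.simps append_Nil2 factor_count_replicate_U power_0 mult_1)
  next
    case (2 a p)
    then show ?case
      by (simp only: ascent_weight.simps replicate_app_Cons_same replicate_Suc append_Cons)
  next
    case (3 a p)
    then show ?case
      by (simp only: ascent_weight.simps factor_count_replicate_U_D zero_less_one zero_less_numeral
            replicate_0 append_Nil power_add)
         (auto simp: peak_weight_def)
  qed
  then show ?thesis
    by (simp add: numeral_2_eq_2)
qed

text \<open>The value of \<open>W n k\<close> at a real \<open>t\<close>. With \<open>t\<close>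
  fixed, coefficients can be compared in \<open>y\<close> alone.\<close>

definition peak_poly :: "nat \<Rightarrow> nat \<Rightarrow> real \<Rightarrow> real" where
  "peak_poly n k t = (\<Sum>m\<le>k. real (w n k m) * t ^ m)"

lemma finite_dyck_path: "finite {p. dyck_path n p}"
  by (simp add: dyck_path_iff finite_paths)

lemma peak_poly_eq:
  "peak_poly n k t = (\<Sum>p | dyck_path n p \<and> factor_count [U, D] p = k. t ^ factor_count [U, U, D] p)"
proof -
  let ?A = "{p. dyck_path n p \<and> factor_count [U, D] p = k}"
  have fin: "finite ?A"
    using finite_dyck_path[of n] by simp
  have "(\<Sum>p\<in>?A. t ^ factor_count [U, U, D] p) =
     (\<Sum>m\<le>k. \<Sum>p\<in>{p \<in> ?A. factor_count [U, U, D] p = m}. t ^ factor_count [U, U, D] p)"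
    using factor_count_UUD_le by (intro sum.group[symmetric] fin) auto
  also have "\<dots> = peak_poly n k t"
    by (simp add: peak_poly_def w_def conj_assoc)
  finally show ?thesis ..
qed

text \<open>The bound \<open>M\<close> is left free so that a later comparison of coefficients can
  use one range for both sides; \<open>2 * n\<close> is the path length and so bounds the number of
  peaks.\<close>

lemma peak_poly_generating_function:
  assumes "M \<ge> 2 * n"
  shows "real (Suc n) * (\<Sum>k\<le>M. peak_poly n k t * y ^ k) = (Abs_fps (peak_weight y t) ^ Suc n) $ n"
proof -
  have "(\<Sum>k\<le>M. peak_poly n k t * y ^ k) =
     (\<Sum>k\<le>M. \<Sum>p\<in>{p \<in> paths 0 n. factor_count [U, D] p = k}. ascent_weight (peak_weight y t) 0 p)"
    by (simp add: peak_poly_eq dyck_path_iff ascent_weight_peak_weight sum_distrib_left mult.commute[of _ "y ^ _"])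
  also have "\<dots> = (\<Sum>p\<in>paths 0 n. ascent_weight (peak_weight y t) 0 p)"
  proof (rule sum.group[OF finite_paths])
    show "factor_count [U, D] ` paths 0 n \<subseteq> {..M}"
    proof clarsimp
      fix p assume "p \<in> paths 0 n"
      then have "length p = 2 * n"
        using descends_length by (auto simp: paths_def)
      then show "factor_count [U, D] p \<le> M"
        using factor_count_le_length[of "[U, D]" p] assms by simp
    qed
  qed simp
  finally show ?thesis
    using sum_ascent_weight[of "peak_weight y t" n] by (simp add: peak_weight_def)
qed

text \<open>The series \<open>z / (1 - z)\<close>.\<close>

definition nonempty_ascent_fps :: "real fps" where
  "nonempty_ascent_fps = Abs_fps (\<lambda>n. if n = 0 then 0 else 1)"

text \<open>The coefficient counts compositions of \<open>n\<close> into \<open>m + 1\<close>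
  positive parts. Multiplying \<open>E = z + z E\<close> by a power of \<open>E\<close> yields
  Pascal's rule. The case \<open>n = 0\<close> is separate since truncated subtraction would give 1
  at \<open>m = 0\<close>.\<close>

lemma nonempty_ascent_fps_power_nth:
  "(nonempty_ascent_fps ^ Suc m) $ n = (if n = 0 then 0 else real ((n - 1) choose m))"
proof (induction m arbitrary: n)
  case 0
  then show ?case by (simp add: nonempty_ascent_fps_def)
next
  case (Suc m)
  let ?E = nonempty_ascent_fps
  have E: "?E = fps_X + fps_X * ?E"
    by (rule fps_ext) (auto simp: nonempty_ascent_fps_def)
  have rec: "?E ^ Suc (Suc m) = fps_X * (?E ^ Suc m + ?E ^ Suc (Suc m))"
    by (subst (1) power_Suc, subst (1) E) (simp add: algebra_simps)
  show ?case
  proof (induction n)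
    case 0
    then show ?case by (subst rec) simp
  next
    case (Suc n)
    have "(?E ^ Suc (Suc m)) $ Suc n = (?E ^ Suc m) $ n + (?E ^ Suc (Suc m)) $ n"
      by (subst rec) simp
    also have "\<dots> = (if n = 0 then 0 else real ((n - 1) choose m)) + (if n = 0 then 0 else real ((n - 1) choose Suc m))"
      by (simp only: Suc.IH \<open>\<And>n. (?E ^ Suc m) $ n = _\<close>)
    also have "\<dots> = real (n choose Suc m)"
      by (cases n) simp_all
    finally show ?case by simp
  qed
qed

text \<open>The series is \<open>1 + y z (1 + t E)\<close>. The binomial theorem is applied first in
  \<open>y\<close>, then in \<open>t\<close>, and \<open>z ^ k\<close> shifts the index to
  \<open>n - k\<close>.\<close>

lemma peak_weight_fps_power_nth:
  "(Abs_fps (peak_weight y t) ^ N) $ n =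
   (\<Sum>k\<le>N. (real (N choose k) *
      (if k \<le> n then (\<Sum>m\<le>k. real (k choose m) * t ^ m * (nonempty_ascent_fps ^ m) $ (n - k)) else 0)) * y ^ k)"
proof -
  let ?E = nonempty_ascent_fps
  have weight: "Abs_fps (peak_weight y t) = fps_const y * (fps_X * (fps_const t * ?E + 1)) + 1"
  proof (rule fps_ext)
    show "Abs_fps (peak_weight y t) $ c = (fps_const y * (fps_X * (fps_const t * ?E + 1)) + 1) $ c" for c
      by (cases c) (simp_all add: peak_weight_def nonempty_ascent_fps_def)
  qed
  have "((fps_X * (fps_const t * ?E + 1)) ^ k) $ n =
     (if k \<le> n then (\<Sum>m\<le>k. real (k choose m) * t ^ m * (?E ^ m) $ (n - k)) else 0)" for k
    by (simp add: power_mult_distrib fps_X_power_mult_nth binomial_ring fps_sum_nth mult.assoc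
             fps_const_power fps_of_nat[symmetric])
  moreover have "((fps_const y * B + 1) ^ N) $ n = (\<Sum>k\<le>N. real (N choose k) * (B ^ k) $ n * y ^ k)" for B :: "real fps"
    by (simp add: binomial_ring[of _ 1] fps_sum_nth power_mult_distrib mult.assoc fps_const_power fps_of_nat[symmetric])
       (simp add: mult_ac)
  ultimately show ?thesis
    unfolding weight by simp
qed

text \<open>For fixed \<open>t\<close>, both sides are coefficients of the same polynomial in
  \<open>y\<close>.\<close>

lemma peak_poly_formula:
  "real (Suc n) * peak_poly n k t = real (Suc n choose k) *
      (if k \<le> n then (\<Sum>m\<le>k. real (k choose m) * t ^ m * (nonempty_ascent_fps ^ m) $ (n - k)) else 0)"
proof -
  obtain M where M: "2 * n \<le> M" "k \<le> M" "Suc n \<le> M"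
    using that[of "2 * n + k + 1"] by simp
  define T where "T k = (if k \<le> n then (\<Sum>m\<le>k. real (k choose m) * t ^ m * (nonempty_ascent_fps ^ m) $ (n - k)) else 0)" for k
  have "(\<Sum>k\<le>M. (real (Suc n) * peak_poly n k t) * y ^ k) = (\<Sum>k\<le>M. (real (Suc n choose k) * T k) * y ^ k)" for y
  proof -
    have "(\<Sum>k\<le>M. (real (Suc n) * peak_poly n k t) * y ^ k) = (Abs_fps (peak_weight y t) ^ Suc n) $ n"
      unfolding peak_poly_generating_function[OF M(1), symmetric] sum_distrib_left mult.assoc ..
    also have "\<dots> = (\<Sum>k\<le>Suc n. (real (Suc n choose k) * T k) * y ^ k)"
      by (simp only: peak_weight_fps_power_nth T_def)
    also have "\<dots> = (\<Sum>k\<le>M. (real (Suc n choose k) * T k) * y ^ k)"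
      by (rule sum.mono_neutral_left) (use M in auto)
    finally show ?thesis .
  qed
  then have "\<forall>k\<le>M. real (Suc n) * peak_poly n k t = real (Suc n choose k) * T k"
    by (intro polyfun_eq_coeffs[THEN iffD1] allI)
  then show ?thesis
    using M by (simp add: T_def)
qed

text \<open>A second comparison of coefficients, now in \<open>t\<close>.\<close>

lemma w_formula:
  assumes "m \<le> k"
  shows "real (Suc n) * real (w n k m) = real (Suc n choose k) *
      (if k \<le> n then real (k choose m) * (nonempty_ascent_fps ^ m) $ (n - k) else 0)"
proof -
  have "(\<Sum>m\<le>k. (real (Suc n) * real (w n k m)) * t ^ m) =
     (\<Sum>m\<le>k. (real (Suc n choose k) *
      (if k \<le> n then real (k choose m) * (nonempty_ascent_fps ^ m) $ (n - k) else 0)) * t ^ m)" for t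
    using peak_poly_formula[of n k t]
    by (auto simp: peak_poly_def sum_distrib_left mult_ac)
  then have "\<forall>m\<le>k. real (Suc n) * real (w n k m) = real (Suc n choose k) *
      (if k \<le> n then real (k choose m) * (nonempty_ascent_fps ^ m) $ (n - k) else 0)"
    by (intro polyfun_eq_coeffs[THEN iffD1] allI)
  then show ?thesis
    using assms by blast
qed

lemma poly_W_complex:
  "poly (map_poly of_real (W n k)) z = (\<Sum>m\<le>k. of_real (real (w n k m)) * z ^ m)"
  for z :: complex
proof -
  have "map_poly complex_of_real (W n k) = (\<Sum>m\<le>k. monom (of_real (real (w n k m))) m)"
    by (rule poly_eqI) (simp add: W_def coeff_map_poly coeff_sum atLeast0AtMost if_distrib cong: if_cong)
  then show ?thesis
    by (simp add: poly_sum poly_monom)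
qed

section \<open>Differentiation preserves real roots\<close>

text \<open>Unlike \<open>real_rooted\<close>, this fails for the zero polynomial, hence the degree
  bounds in the next lemmas.\<close>

definition roots_real :: "complex poly \<Rightarrow> bool" where
  "roots_real p \<longleftrightarrow> (\<forall>z. poly p z = 0 \<longrightarrow> z \<in> \<real>)"

text \<open>Gauss-Lucas for the real line, via the logarithmic derivative of the factorization over
  the complex numbers; multiple roots need no special care.\<close>

lemma roots_real_pderiv:
  assumes "roots_real p" "degree p > 0"
  shows "roots_real (pderiv p)"
proof -
  have "p \<noteq> 0" using assms(2) by auto
  obtain A where A: "size A = degree p" "p = smult (lead_coeff p) (\<Prod>x\<in>#A. [:-x, 1:])"
    using alg_closed_imp_factorization[OF \<open>p \<noteq> 0\<close>] by blast
  define q where "q B = (\<Prod>x\<in>#B. [:-x, 1:])" for B :: "complex multiset"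
  have real: "x \<in> \<real>" if "x \<in># A" for x
  proof -
    have "poly p x = 0"
      by (subst A(2)) (use that in \<open>auto simp: poly_prod_mset\<close>)
    then show ?thesis using assms(1) by (simp add: roots_real_def)
  qed
  \<comment> \<open>\<open>q'/q = \<Sum> 1/(z - x)\<close>, and every summand has imaginary part of sign opposite to \<open>Im z\<close>.\<close>
  have neg: "Im z * Im (poly (pderiv (q B)) z * cnj (poly (q B) z)) \<le> 0 \<and>
      (B \<noteq> {#} \<longrightarrow> Im z * Im (poly (pderiv (q B)) z * cnj (poly (q B) z)) < 0)"
    if "Im z \<noteq> 0" "\<forall>x\<in>#B. x \<in> \<real>" for B z
    using that(2)
  proof (induction B)
    case empty
    then show ?case by (simp add: q_def)
  next
    case (add x B)
    define b b' where "b = poly (q B) z" and "b' = poly (pderiv (q B)) z"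
    have "b \<noteq> 0"
      using add.prems \<open>Im z \<noteq> 0\<close> by (auto simp: b_def q_def poly_prod_mset complex_is_Real_iff)
    have IH: "Im z * Im (b' * cnj b) \<le> 0"
      using add by (simp add: b_def b'_def)
    have q: "q (add_mset x B) = [:-x, 1:] * q B"
      by (simp add: q_def)
    have dq: "pderiv (q (add_mset x B)) = q B + [:-x, 1:] * pderiv (q B)"
      unfolding q pderiv_mult by (simp add: pderiv_pCons)
    have x: "Im x = 0" using add.prems by (simp add: complex_is_Real_iff)
    \<comment> \<open>The product \<open>q' * cnj q\<close> is \<open>q'/q\<close> times
      \<open>|q|^2\<close>, so no division occurs. The new root contributes a strictly negative
      term, and for the old ones the weak inequality suffices.\<close>
    have "poly (pderiv (q (add_mset x B))) z * cnj (poly (q (add_mset x B)) z) =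
        (b * cnj b) * cnj (z - x) + ((z - x) * cnj (z - x)) * (b' * cnj b)"
    proof -
      have "poly (pderiv (q (add_mset x B))) z = b + (z - x) * b'"
        unfolding dq poly_add poly_mult by (simp add: b_def b'_def algebra_simps)
      moreover have "poly (q (add_mset x B)) z = (z - x) * b"
        unfolding q poly_mult by (simp add: b_def algebra_simps)
      ultimately show ?thesis by (simp only:) (simp add: algebra_simps)
    qed
    also have "\<dots> = of_real ((cmod b)\<^sup>2) * cnj (z - x) + of_real ((cmod (z - x))\<^sup>2) * (b' * cnj b)"
      by (simp only: complex_norm_square)
    finally have "Im z * Im (poly (pderiv (q (add_mset x B))) z * cnj (poly (q (add_mset x B)) z)) =
        (cmod (z - x))\<^sup>2 * (Im z * Im (b' * cnj b)) - (cmod b)\<^sup>2 * (Im z)\<^sup>2"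
      by (simp only: plus_complex.sel Im_complex_of_real Re_complex_of_real times_complex.sel complex_cnj minus_complex.sel cnj.sel x)
         (simp add: algebra_simps power2_eq_square)
    moreover have "(cmod (z - x))\<^sup>2 * (Im z * Im (b' * cnj b)) \<le> 0"
      using IH by (simp add: mult_nonneg_nonpos)
    moreover have "(cmod b)\<^sup>2 * (Im z)\<^sup>2 > 0"
      using \<open>b \<noteq> 0\<close> \<open>Im z \<noteq> 0\<close> by simp
    ultimately show ?case by simp
  qed
  show ?thesis
    unfolding roots_real_def
  proof (intro allI impI)
    fix z assume "poly (pderiv p) z = 0"
    moreover have "pderiv p = smult (lead_coeff p) (pderiv (q A))"
      by (subst A(2)) (simp only: q_def pderiv_smult)
    ultimately have "poly (pderiv (q A)) z = 0"
      using \<open>p \<noteq> 0\<close> by simp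
    moreover have "A \<noteq> {#}" using A(1) assms(2) by auto
    ultimately have "Im z = 0"
      using neg[of z A] real by fastforce
    then show "z \<in> \<real>" by (simp add: complex_is_Real_iff)
  qed
qed

lemma roots_real_higher_pderiv:
  assumes "roots_real p" "k \<le> degree p"
  shows "roots_real ((pderiv ^^ k) p)"
  using assms(2)
proof (induction k)
  case 0
  then show ?case using assms(1) by simp
next
  case (Suc k)
  then show ?case
    by (simp add: roots_real_pderiv degree_higher_pderiv)
qed

section \<open>Leibniz rule and derivatives of linear powers\<close>

lemma higher_pderiv_mult:
  fixes p q :: "complex poly"
  shows "(pderiv ^^ n) (p * q) =
    (\<Sum>i\<le>n. of_nat (n choose i) * (pderiv ^^ i) p * (pderiv ^^ (n - i)) q)"
proof (induction n)
  case 0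
  then show ?case by simp
next
  case (Suc n)
  define F where "F i j = (pderiv ^^ i) p * (pderiv ^^ j) q" for i j
  have dF: "pderiv (F i j) = F (Suc i) j + F i (Suc j)" for i j
    by (simp add: F_def pderiv_mult algebra_simps)
  \<comment> \<open>Splitting off \<open>i = 0\<close> lets Pascal's rule break up the other
    binomial coefficients.\<close>
  have "(\<Sum>i\<le>Suc n. of_nat (Suc n choose i) * F i (Suc n - i)) =
      F 0 (Suc n) + (\<Sum>i\<le>n. of_nat (n choose i) * F (Suc i) (n - i) + of_nat (n choose Suc i) * F (Suc i) (n - i))"
    by (subst sum.atMost_Suc_shift) (simp add: algebra_simps)
  also have "\<dots> = (\<Sum>i\<le>n. of_nat (n choose i) * F (Suc i) (n - i)) +
      (\<Sum>i\<le>Suc n. of_nat (n choose i) * F i (Suc n - i))"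
    by (subst sum.atMost_Suc_shift) (simp add: sum.distrib)
  also have "\<dots> = (\<Sum>i\<le>n. of_nat (n choose i) * (F (Suc i) (n - i) + F i (Suc (n - i))))"
    by (simp add: sum.distrib ring_distribs Suc_diff_le binomial_eq_0)
  also have "\<dots> = pderiv (\<Sum>i\<le>n. of_nat (n choose i) * F i (n - i))"
    using higher_pderiv_sum[of 1 "\<lambda>i. of_nat (n choose i) * F i (n - i)" "{..n}"]
    by (simp add: pderiv_mult dF)
  also have "\<dots> = (pderiv ^^ Suc n) (p * q)"
    using Suc.IH by (simp add: F_def mult.assoc)
  finally show ?case by (simp add: F_def mult.assoc)
qed

lemma higher_pderiv_linear_power:
  fixes c :: complex
  assumes "i \<le> n"
  shows "(pderiv ^^ i) ([:c, 1:] ^ n) = smult (of_nat (fact n) / of_nat (fact (n - i))) ([:c, 1:] ^ (n - i))"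
  using assms
proof (induction i)
  case 0
  then show ?case by simp
next
  case (Suc i)
  then obtain m where m: "n - i = Suc m" "n - Suc i = m"
    by (metis Suc_diff_Suc Suc_le_lessD)
  have "(pderiv ^^ Suc i) ([:c, 1:] ^ n) = smult (of_nat (fact n) / of_nat (fact (Suc m))) (pderiv ([:c, 1:] ^ Suc m))"
    using Suc by (simp add: pderiv_smult m del: power_Suc fact_Suc)
  also have "pderiv ([:c, 1:] ^ Suc m) = smult (of_nat (Suc m)) ([:c, 1:] ^ m)"
    by (simp add: pderiv_power_Suc pderiv_pCons del: power_Suc)
  also have "smult (of_nat (fact n) / of_nat (fact (Suc m))) (smult (of_nat (Suc m)) ([:c, 1:] ^ m)) =
      smult (of_nat (fact n) / of_nat (fact m)) ([:c, 1:] ^ m)"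
    by (simp only: smult_smult fact_Suc of_nat_mult of_nat_id) (simp del: of_nat_Suc)
  finally show ?case
    by (simp only: m)
qed

lemma higher_pderiv_eq_0:
  fixes p :: "complex poly"
  assumes "degree p < i"
  shows "(pderiv ^^ i) p = 0"
proof -
  obtain j where j: "i = Suc j" using assms by (cases i) auto
  then show ?thesis using assms by (simp add: pderiv_eq_0_iff degree_higher_pderiv)
qed

section \<open>Zeros of the binomial sum\<close>

lemma roots_real_binomial_sum:
  fixes z :: complex
  assumes "k > 0" "N > 0"
    and zero: "(\<Sum>m=1..k. of_nat (k choose m) * of_nat ((N - 1) choose (m - 1)) * z ^ m) = 0"
  shows "z \<in> \<real>"
proof (cases "z = 0 \<or> z = 1")
  case False
  \<comment> \<open>The exponent \<open>k - 1\<close> makes the Leibniz term \<open>i = 0\<close>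
    vanish and leaves \<open>(1 + x) ^ (i - 1)\<close> in term \<open>i\<close>.\<close>
  define P :: "complex poly" where "P = [:0, 1:] ^ N * [:1, 1:] ^ (k - 1)"
  \<comment> \<open>The inverse of \<open>z = (1 + x) / x\<close>, defined since \<open>z\<close> is
    not 1. That \<open>z\<close> is not 0 permits the division by \<open>z\<close> in
    \<open>summand\<close>.\<close>
  define x where "x = 1 / (z - 1)"
  have x: "x \<noteq> 0" "1 + x = x * z" using False by (auto simp: x_def field_simps)
  have "roots_real P"
    unfolding roots_real_def
  proof (intro allI impI)
    fix y assume "poly P y = 0"
    then have "y = 0 \<or> y = -1" by (auto simp: P_def add_eq_0_iff)
    then show "y \<in> \<real>" by auto
  qed
  moreover have "degree P = N + (k - 1)"
    by (simp add: P_def degree_mult_eq degree_linear_power)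
  \<comment> \<open>Here \<open>N > 0\<close> ensures \<open>k \<le> degree P\<close>.\<close>
  ultimately have roots: "roots_real ((pderiv ^^ k) P)"
    using assms by (intro roots_real_higher_pderiv) auto
  have summand: "poly (of_nat (k choose i) * (pderiv ^^ i) ([:0, 1:] ^ N) * (pderiv ^^ (k - i)) ([:1, 1:] ^ (k - 1))) x
      = of_nat (N * fact (k - 1)) * x ^ (N - 1) * (of_nat (k choose i) * of_nat ((N - 1) choose (i - 1)) * z ^ i) / z"
    if i: "i \<in> {1..k}" for i
  proof (cases "i \<le> N")
    case True
    obtain j where j: "i = Suc j" using i by (cases i) auto
    obtain M where M: "N = Suc M" using assms by (cases N) auto
    have "j \<le> M" using True by (simp add: j M)
    have e: "k - 1 - (k - i) = j" using i j by simp
    have "of_nat (fact N) / of_nat (fact (N - i)) * (of_nat (fact (k - 1)) / of_nat (fact j))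
       = (of_nat (N * fact (k - 1) * (M choose j)) :: complex)"
      using \<open>j \<le> M\<close> by (simp add: binomial_fact j M field_simps)
    moreover have "x ^ (N - i) * (1 + x) ^ j = x ^ (N - 1) * z ^ j"
    proof -
      have "x ^ (N - i) * (1 + x) ^ j = x ^ (N - i + j) * z ^ j"
        unfolding x(2) by (simp only: power_mult_distrib power_add mult.assoc)
      also have "N - i + j = N - 1" using \<open>j \<le> M\<close> by (simp add: j M)
      finally show ?thesis .
    qed
    moreover have "poly (of_nat (k choose i) * (pderiv ^^ i) ([:0, 1:] ^ N) * (pderiv ^^ (k - i)) ([:1, 1:] ^ (k - 1))) x
       = of_nat (k choose i) * (of_nat (fact N) / of_nat (fact (N - i)) * (of_nat (fact (k - 1)) / of_nat (fact j)))
         * (x ^ (N - i) * (1 + x) ^ j)"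
    proof -
      have d1: "(pderiv ^^ i) ([:0, 1:] ^ N) = smult (of_nat (fact N) / of_nat (fact (N - i))) ([:0, 1:] ^ (N - i) :: complex poly)"
        using True by (rule higher_pderiv_linear_power)
      have "k - i \<le> k - 1" using i by (intro diff_le_mono2) simp
      from higher_pderiv_linear_power[OF this, of 1]
      have d2: "(pderiv ^^ (k - i)) ([:1, 1:] ^ (k - 1)) = smult (of_nat (fact (k - 1)) / of_nat (fact j)) ([:1, 1:] ^ j :: complex poly)"
        by (simp only: e)
      show ?thesis
        unfolding d1 d2 by (simp add: mult_ac del: of_nat_fact)
    qed
    ultimately show ?thesis
      using False by (simp only:) (simp add: j M mult_ac)
  next
    case False
    \<comment> \<open>For \<open>i > N\<close> both sides vanish.\<close>
    then have "(pderiv ^^ i) ([:0, 1:] ^ N :: complex poly) = 0"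
      by (intro higher_pderiv_eq_0) (simp add: degree_linear_power)
    moreover have "(N - 1) choose (i - 1) = 0"
      using False assms by (intro binomial_eq_0) auto
    ultimately show ?thesis by simp
  qed
  have "(pderiv ^^ k) ([:1, 1:] ^ (k - 1) :: complex poly) = 0"
    using assms by (intro higher_pderiv_eq_0) (simp add: degree_linear_power)
  then have "poly ((pderiv ^^ k) P) x =
      (\<Sum>i=1..k. poly (of_nat (k choose i) * (pderiv ^^ i) ([:0, 1:] ^ N) * (pderiv ^^ (k - i)) ([:1, 1:] ^ (k - 1))) x)"
    unfolding P_def higher_pderiv_mult poly_sum
    by (simp add: sum.atLeast_Suc_atMost[of 0 k] flip: atLeast0AtMost)
  also have "\<dots> = of_nat (N * fact (k - 1)) * x ^ (N - 1) *
      (\<Sum>i=1..k. of_nat (k choose i) * of_nat ((N - 1) choose (i - 1)) * z ^ i) / z"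
    unfolding sum_distrib_left sum_divide_distrib by (rule sum.cong[OF refl], rule summand)
  also have "\<dots> = 0" by (simp only: zero) simp
  finally have "poly ((pderiv ^^ k) P) x = 0" .
  then have "x \<in> \<real>" using roots by (simp add: roots_real_def)
  moreover have "z = 1 + 1 / x" using False by (simp add: x_def)
  ultimately show ?thesis by simp
qed auto

section \<open>From the binomial sum to \<open>W n k\<close>\<close>

theorem theorem6p3:
  fixes n k :: nat
  shows "real_rooted (W n k)"
proof -
  let ?z = "\<lambda>z. poly (map_poly of_real (W n k)) z = 0"
  \<comment> \<open>Outside \<open>0 < k < n\<close> the polynomial is constant: for
    \<open>k > n\<close> it is zero, and for \<open>n = k > 0\<close> only \<open>m = 0\<close>
    survives, as positive powers of \<open>z / (1 - z)\<close> have no constant term.\<close>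
  consider "k = 0" | "k > n" | "k > 0" "n = k" | "k > 0" "n > k"
    by linarith
  then show ?thesis
  proof cases
    case 1
    then show ?thesis by (simp add: real_rooted_def W_def monom_0)
  next
    case 2
    then have "w n k m = 0" if "m \<le> k" for m
      using w_formula[OF that, of n] by simp
    then have "W n k = 0" by (simp add: W_def)
    then show ?thesis by (simp add: real_rooted_def)
  next
    case 3
    have "w n k m = 0" if "m \<in> {1..k}" for m
    proof -
      obtain j where "m = Suc j" using \<open>m \<in> {1..k}\<close> by (cases m) auto
      then show ?thesis
        using w_formula[of m k n] nonempty_ascent_fps_power_nth[of j 0] that 3
        by (simp del: power_Suc)
    qed
    then have "W n k = monom (real (w n k 0)) 0"
      by (simp add: W_def sum.atLeast_Suc_atMost[of 0 k])
    then show ?thesis by (simp add: real_rooted_def monom_0)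
  next
    case 4
    define c where "c = real (Suc n choose k) / real (Suc n)"
    have "c \<noteq> 0" using 4 by (simp add: c_def)
    have w: "real (w n k m) = c * (real (k choose m) * (nonempty_ascent_fps ^ m) $ (n - k))" if "m \<le> k" for m
      using w_formula[OF that, of n] 4 by (simp add: c_def field_simps)
    \<comment> \<open>Since \<open>n - k > 0\<close>, the zeroth power of the series contributes
      nothing, so the sum starts at \<open>m = 1\<close>.\<close>
    have w0: "real (w n k 0) = 0"
      using w[of 0] 4 by simp
    have w1: "real (w n k m) = c * (real (k choose m) * real ((n - k - 1) choose (m - 1)))"
      if "m \<in> {1..k}" for m
    proof -
      obtain j where "m = Suc j" using \<open>m \<in> {1..k}\<close> by (cases m) auto
      have "(nonempty_ascent_fps ^ Suc j) $ (n - k) = real ((n - k - 1) choose j)"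
        unfolding nonempty_ascent_fps_power_nth using 4 by simp
      then have "(nonempty_ascent_fps ^ m) $ (n - k) = real ((n - k - 1) choose (m - 1))"
        by (simp only: \<open>m = Suc j\<close> diff_Suc_1)
      moreover have "m \<le> k" using \<open>m \<in> {1..k}\<close> by simp
      ultimately show ?thesis by (simp only: w)
    qed
    have "poly (map_poly of_real (W n k)) z =
        of_real c * (\<Sum>m=1..k. of_nat (k choose m) * of_nat ((n - k - 1) choose (m - 1)) * z ^ m)"
      for z :: complex
    proof -
      have "poly (map_poly of_real (W n k)) z = (\<Sum>m=1..k. of_real (real (w n k m)) * z ^ m)"
        unfolding poly_W_complex using w0
        by (simp add: sum.atLeast_Suc_atMost[of 0 k] flip: atLeast0AtMost)
      also have "\<dots> = of_real c * (\<Sum>m=1..k. of_nat (k choose m) * of_nat ((n - k - 1) choose (m - 1)) * z ^ m)"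
        unfolding sum_distrib_left by (rule sum.cong[OF refl]) (simp only: w1 of_real_mult of_real_of_nat_eq mult.assoc)
      finally show ?thesis .
    qed
    then show ?thesis
      using roots_real_binomial_sum[of k "n - k"] 4 \<open>c \<noteq> 0\<close> by (auto simp: real_rooted_def)
  qed
qed

end
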